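(* For any normal FASP program $\Pi=\{r_1,\dots,r_n\}$ of signature $\sigma$, let $F$ be the fuzzy formula $r_1\otimes\dots\otimes r_n$, where $\otimes$ is any fuzzy conjunction. An interpretation $I$ of $\sigma$ is a fuzzy answer set of $\Pi$ if and only if $I$ is a stable model of $F$ (relative to $\sigma$).
   Context: A fuzzy propositional signature $\sigma$ is a set of symbols (fuzzy atoms). Fuzzy formulas of $\sigma$ are built from atoms of $\sigma$ and numeric constants $c\in[0,1]$ using fuzzy operators, identified with functions on $[0,1]$. A fuzzy conjunction $\otimes:[0,1]^2\to[0,1]$ is any function that is (non-strictly) increasing in both arguments, commutative, associative, with $\otimes(1,x)=x$. Also $\otimes_m(x,y)=\min(x,y)$, $\neg_s(x)=1-x$, and $\rightarrow_r\!(x,y)=1$ if $x\le y$ and $=y$ otherwise. An interpretation is a map $I:\sigma\to[0,1]$, with truth values $\upsilon_I(p)=I(p)$, $\upsilon_I(c)=c$, $\upsilon_I(\neg_s F)=1-\upsilon_I(F)$, $\upsilon_I(F\odot G)=\odot(\upsilon_I(F),\upsilon_I(G))$ for binary operators $\odot$; $I\models F$ means $\upsilon_I(F)=1$. Write $J<^\sigma I$ if $J\ne I$ and $J(p)\le I(p)$ for all $p\in\sigma$. Reduct and stable models of formulas: $F^I=F$ for $F$ an atom or numeric constant; $(\neg_s F)^I=\upsilon_I(\neg_s F)$ (a numeric constant); $(F\odot G)^I=(F^I\odot G^I)\otimes_m\upsilon_I(F\odot G)$ for every binary operator $\odot$. $I$ is a stable model of $F$ (relative to $\sigma$) if $I\models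 F$ and there is no interpretation $J<^\sigma I$ with $J\models F^I$. Normal FASP programs: a normal FASP program is a finite set of rules $a\leftarrow b_1\otimes\dots\otimes b_m\otimes\neg b_{m+1}\otimes\dots\otimes\neg b_n$ where $n\ge m\ge 0$, $a,b_1,\dots,b_n$ are fuzzy atoms or numeric constants in $[0,1]$, and $\otimes$ is any fuzzy conjunction. The rule is identified with the fuzzy formula $b_1\otimes\dots\otimes b_m\otimes\neg_s b_{m+1}\otimes\dots\otimes\neg_s b_n\rightarrow_r a$. An empty conjunction is the constant $1$. $I$ satisfies a rule $R$ if $\upsilon_I(R)=1$, and satisfies $\Pi$ if it satisfies every rule in $\Pi$. $I$ is a fuzzy answer set of $\Pi$ if $I$ satisfies $\Pi$ and no interpretation $J<^\sigma I$ satisfies the program obtained from $\Pi$ by replacing each negative literal $\neg b$ with the numeric constant $1-\upsilon_I(b)$. *)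

theory Defs
  imports Complex_Main "HOL-Library.FuncSet"
begin

text \<open>Binary fuzzy operators are represented by functions on the reals of which only the
  restriction to \<open>[0,1]\<close> is relevant; all conditions below are relativised to \<open>{0..1}\<close>.\<close>

type_synonym fop = "real \<Rightarrow> real \<Rightarrow> real"

definition fuzzy_operator :: "fop \<Rightarrow> bool" where
  "fuzzy_operator f \<longleftrightarrow> (\<forall>x\<in>{0..1}. \<forall>y\<in>{0..1}. f x y \<in> {0..1})"

definition fuzzy_conjunction :: "fop \<Rightarrow> bool" where
  "fuzzy_conjunction f \<longleftrightarrow>
     fuzzy_operator f \<and>
     (\<forall>x\<in>{0..1}. \<forall>x'\<in>{0..1}. \<forall>y\<in>{0..1}. \<forall>y'\<in>{0..1}. x \<le> x' \<longrightarrow> y \<le> y' \<longrightarrow> f x y \<le> f x' y') \<and>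
     (\<forall>x\<in>{0..1}. \<forall>y\<in>{0..1}. f x y = f y x) \<and>
     (\<forall>x\<in>{0..1}. \<forall>y\<in>{0..1}. \<forall>z\<in>{0..1}. f (f x y) z = f x (f y z)) \<and>
     (\<forall>x\<in>{0..1}. f 1 x = x)"

definition impl_r :: fop where
  "impl_r x y = (if x \<le> y then 1 else y)"

datatype 'a fform =
    Atom 'a
  | Const real
  | Neg "'a fform"
  | Bin fop "'a fform" "'a fform"

primrec fuzzy_formula :: "'a set \<Rightarrow> 'a fform \<Rightarrow> bool" where
  "fuzzy_formula \<sigma> (Atom p) \<longleftrightarrow> p \<in> \<sigma>"
| "fuzzy_formula \<sigma> (Const c) \<longleftrightarrow> c \<in> {0..1}"
| "fuzzy_formula \<sigma> (Neg F) \<longleftrightarrow> fuzzy_formula \<sigma> F"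
| "fuzzy_formula \<sigma> (Bin f F G) \<longleftrightarrow> fuzzy_operator f \<and> fuzzy_formula \<sigma> F \<and> fuzzy_formula \<sigma> G"

text \<open>Interpretations are extensional functions, so that \<open>J \<noteq> I\<close> means that \<open>J\<close> and \<open>I\<close>
  differ at some atom of \<open>\<sigma>\<close>.\<close>

definition interpretations :: "'a set \<Rightarrow> ('a \<Rightarrow> real) set" where
  "interpretations \<sigma> = (\<sigma> \<rightarrow>\<^sub>E {0..1})"

definition interp_less :: "'a set \<Rightarrow> ('a \<Rightarrow> real) \<Rightarrow> ('a \<Rightarrow> real) \<Rightarrow> bool" where
  "interp_less \<sigma> J I \<longleftrightarrow> J \<noteq> I \<and> (\<forall>p\<in>\<sigma>. J p \<le> I p)"

primrec truth_value :: "('a \<Rightarrow> real) \<Rightarrow> 'a fform \<Rightarrow> real" where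
  "truth_value I (Atom p) = I p"
| "truth_value I (Const c) = c"
| "truth_value I (Neg F) = 1 - truth_value I F"
| "truth_value I (Bin f F G) = f (truth_value I F) (truth_value I G)"

definition satisfies :: "('a \<Rightarrow> real) \<Rightarrow> 'a fform \<Rightarrow> bool" where
  "satisfies I F \<longleftrightarrow> truth_value I F = 1"

primrec reduct :: "('a \<Rightarrow> real) \<Rightarrow> 'a fform \<Rightarrow> 'a fform" where
  "reduct I (Atom p) = Atom p"
| "reduct I (Const c) = Const c"
| "reduct I (Neg F) = Const (truth_value I (Neg F))"
| "reduct I (Bin f F G) =
     Bin min (Bin f (reduct I F) (reduct I G)) (Const (truth_value I (Bin f F G)))"

definition stable_model :: "'a set \<Rightarrow> 'a fform \<Rightarrow> ('a \<Rightarrow> real) \<Rightarrow> bool" where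
  "stable_model \<sigma> F I \<longleftrightarrow>
     I \<in> interpretations \<sigma> \<and> satisfies I F \<and>
     \<not> (\<exists>J\<in>interpretations \<sigma>. interp_less \<sigma> J I \<and> satisfies J (reduct I F))"

text \<open>Iterated conjunctions associate to the left; the empty one is the constant 1.\<close>

fun big_conj :: "fop \<Rightarrow> 'a fform list \<Rightarrow> 'a fform" where
  "big_conj f [] = Const 1"
| "big_conj f (F # Fs) = foldl (Bin f) F Fs"

text \<open>A rule \<open>a \<leftarrow> b\<^sub>1 \<otimes> \<dots> \<otimes> b\<^sub>m \<otimes> \<not> b\<^sub>m\<^sub>+\<^sub>1 \<otimes> \<dots> \<otimes> \<not> b\<^sub>n\<close> is represented as
  \<open>Rule f a [b\<^sub>1, \<dots>, b\<^sub>m] [b\<^sub>m\<^sub>+\<^sub>1, \<dots>, b\<^sub>n]\<close>, where \<open>f\<close> is the fuzzy conjunction \<open>\<otimes>\<close> used in its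
  body; different rules of a program may use different conjunctions.\<close>

datatype 'a rule =
  Rule (rule_conj: fop) (rule_head: "'a fform")
    (pos_body: "'a fform list") (neg_body: "'a fform list")

definition atom_or_const :: "'a set \<Rightarrow> 'a fform \<Rightarrow> bool" where
  "atom_or_const \<sigma> F \<longleftrightarrow> (\<exists>p\<in>\<sigma>. F = Atom p) \<or> (\<exists>c\<in>{0..1}. F = Const c)"

definition normal_rule :: "'a set \<Rightarrow> 'a rule \<Rightarrow> bool" where
  "normal_rule \<sigma> r \<longleftrightarrow>
     fuzzy_conjunction (rule_conj r) \<and> atom_or_const \<sigma> (rule_head r) \<and>
     (\<forall>b\<in>set (pos_body r) \<union> set (neg_body r). atom_or_const \<sigma> b)"

definition normal_FASP_program :: "'a set \<Rightarrow> 'a rule set \<Rightarrow> bool" where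
  "normal_FASP_program \<sigma> P \<longleftrightarrow> finite P \<and> (\<forall>r\<in>P. normal_rule \<sigma> r)"

definition rule_formula :: "'a rule \<Rightarrow> 'a fform" where
  "rule_formula r =
     Bin impl_r (big_conj (rule_conj r) (pos_body r @ map Neg (neg_body r))) (rule_head r)"

definition satisfies_program :: "('a \<Rightarrow> real) \<Rightarrow> 'a rule set \<Rightarrow> bool" where
  "satisfies_program I P \<longleftrightarrow> (\<forall>r\<in>P. satisfies I (rule_formula r))"

definition rule_reduct :: "('a \<Rightarrow> real) \<Rightarrow> 'a rule \<Rightarrow> 'a rule" where
  "rule_reduct I r =
     Rule (rule_conj r) (rule_head r)
       (pos_body r @ map (\<lambda>b. Const (1 - truth_value I b)) (neg_body r)) []"

definition fuzzy_answer_set :: "'a set \<Rightarrow> 'a rule set \<Rightarrow> ('a \<Rightarrow> real) \<Rightarrow> bool" where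
  "fuzzy_answer_set \<sigma> P I \<longleftrightarrow>
     I \<in> interpretations \<sigma> \<and> satisfies_program I P \<and>
     \<not> (\<exists>J\<in>interpretations \<sigma>. interp_less \<sigma> J I \<and> satisfies_program J (rule_reduct I ` P))"

lemma fuzzy_formula_foldl:
  "fuzzy_operator f \<Longrightarrow> fuzzy_formula \<sigma> F \<Longrightarrow> \<forall>G\<in>set Fs. fuzzy_formula \<sigma> G
    \<Longrightarrow> fuzzy_formula \<sigma> (foldl (Bin f) F Fs)"
  by (induction Fs arbitrary: F) auto

lemma fuzzy_formula_big_conj:
  "fuzzy_operator f \<Longrightarrow> \<forall>G\<in>set Fs. fuzzy_formula \<sigma> G \<Longrightarrow> fuzzy_formula \<sigma> (big_conj f Fs)"
  by (cases Fs) (auto intro: fuzzy_formula_foldl)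

lemma fuzzy_formula_rule_formula:
  assumes "normal_rule \<sigma> r"
  shows "fuzzy_formula \<sigma> (rule_formula r)"
proof -
  have "fuzzy_formula \<sigma> G" if "atom_or_const \<sigma> G" for G
    using that by (auto simp: atom_or_const_def)
  then show ?thesis
    using assms unfolding rule_formula_def normal_rule_def fuzzy_conjunction_def
    by (auto simp: fuzzy_operator_def impl_r_def intro!: fuzzy_formula_big_conj)
qed

end

theory Submission
  imports Defs
begin

text \<open>For \<open>J \<le> I\<close> every formula satisfies \<open>v\<^sub>J(F\<^sup>I) \<le> v\<^sub>I(F)\<close>. A fuzzy conjunction is monotone,
  so the minimum that the reduct attaches to it is redundant below \<open>I\<close>: the reduct of a conjunction
  has the same value as the conjunction of the reducts. If \<open>I\<close> satisfies a rule, the minimum attached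
  to the implication is redundant as well, so the reduct of the rule has the value of the rule with
  each negative literal replaced by its value under \<open>I\<close>. As a fuzzy conjunction equals 1 only if all
  its arguments do, the two notions quantify over the same \<open>J\<close>.\<close>

lemma interpretations_atom:
  "I \<in> interpretations \<sigma> \<Longrightarrow> p \<in> \<sigma> \<Longrightarrow> I p \<in> {0..1}"
  unfolding interpretations_def by (rule PiE_mem)

lemma truth_value_unit_interval:
  assumes "fuzzy_formula \<sigma> F" "I \<in> interpretations \<sigma>"
  shows "truth_value I F \<in> {0..1}"
  using assms by (induction F) (auto simp: fuzzy_operator_def dest: interpretations_atom)

lemma fuzzy_operator_min: "fuzzy_operator min"
  by (auto simp: fuzzy_operator_def)

text \<open>The laws of a fuzzy conjunction are assumed on \<open>{0..1}\<close> only, so values of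
  reducts must be known to lie there. The constants that the reduct inserts are truth values under
  \<open>I\<close>.\<close>

lemma fuzzy_formula_reduct:
  assumes "fuzzy_formula \<sigma> F" "I \<in> interpretations \<sigma>"
  shows "fuzzy_formula \<sigma> (reduct I F)"
  using assms(1)
proof (induction F)
  case (Neg F)
  then show ?case using truth_value_unit_interval[of \<sigma> F I] assms(2) by auto
next
  case (Bin g F G)
  then show ?case
    using truth_value_unit_interval[of \<sigma> "Bin g F G" I] assms(2) fuzzy_operator_min by auto
qed auto

text \<open>A case distinction suffices: atoms are compared by \<open>interp_less\<close>, constants
  and negations reduce to their value under \<open>I\<close>, and for \<open>Bin\<close> the
  attached minimum gives the bound for any operator.\<close>

lemma truth_value_reduct_le:
  assumes "fuzzy_formula \<sigma> F" "interp_less \<sigma> J I"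
  shows "truth_value J (reduct I F) \<le> truth_value I F"
  using assms by (cases F) (auto simp: interp_less_def)

lemma fuzzy_conjunction_mono:
  assumes "fuzzy_conjunction f" "x \<in> {0..1}" "x' \<in> {0..1}" "y \<in> {0..1}" "y' \<in> {0..1}"
    "x \<le> x'" "y \<le> y'"
  shows "f x y \<le> f x' y'"
  using assms unfolding fuzzy_conjunction_def by blast

text \<open>Since 1 is a two-sided unit by commutativity, monotonicity gives \<open>f x y\<close>
  \<le> \<open>f x 1\<close> = \<open>x\<close> and \<open>f x y\<close> \<le> \<open>f 1 y\<close>
  = \<open>y\<close>.\<close>

lemma fuzzy_conjunction_eq_1_iff:
  assumes f: "fuzzy_conjunction f" and x: "x \<in> {0..1}" and y: "y \<in> {0..1}"
  shows "f x y = 1 \<longleftrightarrow> x = 1 \<and> y = 1"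
proof -
  have one: "1 \<in> {0..1::real}" by simp
  have unit: "f 1 z = z" if "z \<in> {0..1}" for z
    using f that unfolding fuzzy_conjunction_def by blast
  moreover have "f x 1 = f 1 x"
    using f x one unfolding fuzzy_conjunction_def by blast
  moreover have "f x y \<le> f x 1" "f x y \<le> f 1 y"
    using x y by (auto intro: fuzzy_conjunction_mono[OF f])
  ultimately have "f x y \<le> x" "f x y \<le> y" using x y by simp_all
  then show ?thesis using unit x y by auto
qed

lemma truth_value_foldl_eq_1_iff:
  assumes "fuzzy_conjunction f" "J \<in> interpretations \<sigma>"
    "fuzzy_formula \<sigma> F" "\<forall>G\<in>set Fs. fuzzy_formula \<sigma> G"
  shows "truth_value J (foldl (Bin f) F Fs) = 1 \<longleftrightarrow> (\<forall>G\<in>set (F # Fs). truth_value J G = 1)"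
  using assms(3,4)
proof (induction Fs arbitrary: F)
  case (Cons H Fs)
  have f: "fuzzy_operator f" using assms(1) by (simp add: fuzzy_conjunction_def)
  have "f (truth_value J F) (truth_value J H) = 1 \<longleftrightarrow> truth_value J F = 1 \<and> truth_value J H = 1"
    using Cons.prems assms(1,2)
    by (intro fuzzy_conjunction_eq_1_iff truth_value_unit_interval) auto
  then show ?case using Cons f by simp
qed simp

lemma satisfies_big_conj_iff:
  assumes "fuzzy_conjunction f" "J \<in> interpretations \<sigma>" "\<forall>G\<in>set Fs. fuzzy_formula \<sigma> G"
  shows "satisfies J (big_conj f Fs) \<longleftrightarrow> (\<forall>G\<in>set Fs. satisfies J G)"
  using truth_value_foldl_eq_1_iff[OF assms(1,2)] assms(3)
  by (cases Fs) (auto simp: satisfies_def)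

text \<open>Allows a rewrite at the innermost position of a left-nested chain when the two formulas
  differ syntactically and agree only in value.\<close>

lemma truth_value_foldl_cong:
  assumes "truth_value J F = truth_value J F'"
  shows "truth_value J (foldl (Bin f) F Fs) = truth_value J (foldl (Bin f) F' Fs)"
  using assms by (induction Fs arbitrary: F F') auto

lemma truth_value_reduct_conj:
  assumes f: "fuzzy_conjunction f" and I: "I \<in> interpretations \<sigma>" and J: "J \<in> interpretations \<sigma>"
    and less: "interp_less \<sigma> J I" and F: "fuzzy_formula \<sigma> F" and G: "fuzzy_formula \<sigma> G"
  shows "truth_value J (reduct I (Bin f F G)) = truth_value J (Bin f (reduct I F) (reduct I G))"
proof -
  have "f (truth_value J (reduct I F)) (truth_value J (reduct I G))
      \<le> f (truth_value I F) (truth_value I G)"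
    by (rule fuzzy_conjunction_mono[OF f
          truth_value_unit_interval[OF fuzzy_formula_reduct[OF F I] J]
          truth_value_unit_interval[OF F I]
          truth_value_unit_interval[OF fuzzy_formula_reduct[OF G I] J]
          truth_value_unit_interval[OF G I]
          truth_value_reduct_le[OF F less] truth_value_reduct_le[OF G less]])
  then show ?thesis by simp
qed

text \<open>Removes the minimum at every level of the chain. It serves both for the body of a rule
  and for the conjunction of all rules.\<close>

lemma truth_value_reduct_big_conj:
  assumes f: "fuzzy_conjunction f" and I: "I \<in> interpretations \<sigma>" and J: "J \<in> interpretations \<sigma>"
    and less: "interp_less \<sigma> J I" and Fs: "\<forall>G\<in>set Fs. fuzzy_formula \<sigma> G"
  shows "truth_value J (reduct I (big_conj f Fs)) = truth_value J (big_conj f (map (reduct I) Fs))"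
proof -
  have op: "fuzzy_operator f" using f by (simp add: fuzzy_conjunction_def)
  have "truth_value J (reduct I (foldl (Bin f) F Gs))
      = truth_value J (foldl (Bin f) (reduct I F) (map (reduct I) Gs))"
    if "fuzzy_formula \<sigma> F" "\<forall>G\<in>set Gs. fuzzy_formula \<sigma> G" for F Gs
    using that
  proof (induction Gs arbitrary: F)
    case (Cons H Gs)
    \<comment> \<open>The induction hypothesis is used with accumulator \<open>Bin f F H\<close>,
      whose reduct stays folded so that its minimum can be removed next.\<close>
    then have "truth_value J (reduct I (foldl (Bin f) F (H # Gs)))
        = truth_value J (foldl (Bin f) (reduct I (Bin f F H)) (map (reduct I) Gs))"
      using op by (simp del: reduct.simps)
    also have "\<dots> = truth_value J (foldl (Bin f) (Bin f (reduct I F) (reduct I H)) (map (reduct I) Gs))"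
      using Cons.prems f I J less by (intro truth_value_foldl_cong truth_value_reduct_conj[of f I \<sigma> J]) auto
    finally show ?case by simp
  qed simp
  then show ?thesis using Fs by (cases Fs) auto
qed

lemma atom_or_const_fuzzy_formula: "atom_or_const \<sigma> F \<Longrightarrow> fuzzy_formula \<sigma> F"
  by (auto simp: atom_or_const_def)

lemma reduct_atom_or_const: "atom_or_const \<sigma> F \<Longrightarrow> reduct I F = F"
  by (auto simp: atom_or_const_def)

text \<open>As \<open>impl_r\<close> is antitone in its first argument, the monotonicity argument
  does not cover it. Instead \<open>sat\<close> makes the minimum attached to the implication a
  minimum with 1.\<close>

lemma satisfies_reduct_rule_formula_iff:
  assumes r: "normal_rule \<sigma> r" and I: "I \<in> interpretations \<sigma>" and J: "J \<in> interpretations \<sigma>"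
    and less: "interp_less \<sigma> J I" and sat: "satisfies I (rule_formula r)"
  shows "satisfies J (reduct I (rule_formula r)) \<longleftrightarrow> satisfies J (rule_formula (rule_reduct I r))"
proof -
  let ?body = "pos_body r @ map Neg (neg_body r)"
  have f: "fuzzy_conjunction (rule_conj r)"
    using r by (simp add: normal_rule_def)
  have "\<forall>b\<in>set (pos_body r) \<union> set (neg_body r). fuzzy_formula \<sigma> b"
    using r atom_or_const_fuzzy_formula unfolding normal_rule_def by blast
  then have lits: "\<forall>G\<in>set ?body. fuzzy_formula \<sigma> G"
    by auto
  \<comment> \<open>Positive literals are their own reducts, and \<open>Neg b\<close> reduces to the
    very constant that \<open>rule_reduct\<close> puts in its place.\<close>
  have "map (reduct I) ?body = pos_body (rule_reduct I r)"
    using r by (auto simp: rule_reduct_def normal_rule_def intro!: map_idI reduct_atom_or_const)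
  then have body: "truth_value J (reduct I (big_conj (rule_conj r) ?body))
      = truth_value J (big_conj (rule_conj r) (pos_body (rule_reduct I r)))"
    using truth_value_reduct_big_conj[OF f I J less lits] by simp
  have head: "reduct I (rule_head r) = rule_head r"
    using r by (auto simp: normal_rule_def intro: reduct_atom_or_const)
  \<comment> \<open>A head value of at most 1 keeps the implication at most 1, so the minimum with 1
    leaves it unchanged.\<close>
  have "truth_value J (rule_head r) \<le> 1"
    using truth_value_unit_interval[OF atom_or_const_fuzzy_formula J] r
    by (simp add: normal_rule_def)
  then have "impl_r x (truth_value J (rule_head r)) \<le> 1" for x
    by (simp add: impl_r_def)
  then show ?thesis
    using sat body head
    by (simp add: satisfies_def rule_formula_def rule_reduct_def)
qed

theorem theorem5:
  fixes \<sigma> :: "'a set" and P :: "'a rule set" and rs :: "'a rule list"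
    and f :: fop and I :: "'a \<Rightarrow> real"
  assumes "normal_FASP_program \<sigma> P"
    and "P = set rs"
    and "fuzzy_conjunction f"
    and "I \<in> interpretations \<sigma>"
  shows "fuzzy_answer_set \<sigma> P I \<longleftrightarrow>
    stable_model \<sigma> (big_conj f (map rule_formula rs)) I"
proof -
  let ?F = "big_conj f (map rule_formula rs)"
  have normal: "normal_rule \<sigma> r" if "r \<in> set rs" for r
    using assms(1,2) that by (simp add: normal_FASP_program_def)
  have formulas: "\<forall>G\<in>set (map rule_formula rs). fuzzy_formula \<sigma> G"
    using normal by (auto intro: fuzzy_formula_rule_formula)
  have sat: "satisfies I ?F \<longleftrightarrow> satisfies_program I P"
    using satisfies_big_conj_iff[OF assms(3,4) formulas] assms(2)
    by (simp add: satisfies_program_def)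
  \<comment> \<open>The restriction to \<open>I\<close> satisfying \<open>P\<close> is harmless: by
    \<open>sat\<close>, both notions require it.\<close>
  have "satisfies J (reduct I ?F) \<longleftrightarrow> satisfies_program J (rule_reduct I ` P)"
    if J: "J \<in> interpretations \<sigma>" and less: "interp_less \<sigma> J I" and P: "satisfies_program I P" for J
  proof -
    have "satisfies J (reduct I ?F) \<longleftrightarrow> satisfies J (big_conj f (map (reduct I) (map rule_formula rs)))"
      using truth_value_reduct_big_conj[OF assms(3,4) J less formulas] by (simp add: satisfies_def)
    also have "\<dots> \<longleftrightarrow> (\<forall>G\<in>set (map (reduct I) (map rule_formula rs)). satisfies J G)"
      using formulas assms(4)
      by (intro satisfies_big_conj_iff[OF assms(3) J]) (auto intro: fuzzy_formula_reduct)
    also have "\<dots> \<longleftrightarrow> (\<forall>r\<in>set rs. satisfies J (rule_formula (rule_reduct I r)))"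
      using satisfies_reduct_rule_formula_iff[OF normal assms(4) J less] P assms(2)
      by (simp add: satisfies_program_def)
    finally show ?thesis using assms(2) by (simp add: satisfies_program_def)
  qed
  then show ?thesis
    using sat unfolding fuzzy_answer_set_def stable_model_def by meson
qed

end
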